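(* Let $n_1,\ldots,n_k$ be integers generating a minimal Hilbert basis and let $\epsilon=(\epsilon_{ij})$ be a real symmetric $k\times k$ matrix with $\epsilon_{ij}=0$ unless $d_i=d_j=1$. Then the Poisson structure $\{\,,\}_\epsilon$ on $\mathbb{C}[S_{n_1,\ldots,n_k}]$ is $F_k$-related to a real Poisson structure on $\mathbb{C}[X_{ij}]$; that is, there is a real Poisson bracket $\{\,,\}$ on $\mathbb{C}[X_{ij}]$ with $$F_k(\{f,g\})=\{F_k(f),F_k(g)\}_\epsilon\qquad\text{for all } f,g\in\mathbb{C}[X_{ij}].$$
   Context: Let $k>1$ and let $n_1,\ldots,n_k$ be positive integers with $\gcd(n_1,\ldots,n_k)=1$. Put $d_i=\gcd(n_1,\ldots,n_{i-1},n_{i+1},\ldots,n_k)$. The integers generate a minimal Hilbert basis if $n_i=d_1\cdots d_{i-1}d_{i+1}\cdots d_k$ for all $i$. Let $e_1,\ldots,e_k,\overline{e}_1,\ldots,\overline{e}_k$ be the standard basis of $\mathbb{Z}^k\times\mathbb{Z}^k$; write an element as $a=\sum_i(a_ie_i+\overline{a}_i\overline{e}_i)$ (so $a_i,\overline a_i$ are independent integers). $S_{n_1,\ldots,n_k}$ is the monoid of all $a$ with all $a_i,\overline{a}_i\ge0$ and $\sum_i n_i(a_i-\overline{a}_i)=0$. Write $X^a=\prod_i z_i^{a_i}\overline{z}_i^{\overline{a}_i}$. $\mathbb{C}[S_{n_1,\ldots,n_k}]$ is the span of the monomials $X^a$, $a\in S_{n_1,\ldots,n_k}$, i.e. the ring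 of polynomials in $z_1,\ldots,z_k,\overline{z}_1,\ldots,\overline{z}_k$ invariant under the circle action $t\cdot(z_1,\ldots,z_k)=(t^{n_1}z_1,\ldots,t^{n_k}z_k)$. For such $\epsilon$, the bracket $\{\,,\}_\epsilon$ on $\mathbb{C}[S_{n_1,\ldots,n_k}]$ is the bilinear antisymmetric Poisson bracket given by $$\{X^a,X^b\}_\epsilon=-2\sqrt{-1}\sum_{i,j}\epsilon_{ij}(a_i\overline{b}_j-\overline{a}_jb_i)X^{a+b-e_i-\overline{e}_j}$$ (terms with zero coefficient are omitted); it is the restriction of the bracket on $\mathbb{C}[z,\overline z]$ with $\{z_i,\overline{z}_j\}=-2\sqrt{-1}\,\epsilon_{ij}$, $\{z_i,z_j\}=\{\overline z_i,\overline z_j\}=0$. $\mathbb{C}[X_{ij}]$ is the polynomial ring in the $k^2$ variables $X_{ij}$, $1\le i,j\le k$. The algebra homomorphism $F_k:\mathbb{C}[X_{ij}]\to\mathbb{C}[S_{n_1,\ldots,n_k}]$ is given by $F_k(X_{ii})=z_i\overline{z}_i$ and $F_k(X_{ij})=z_i^{d_i}\overline{z}_j^{d_j}$ for $i\ne j$. A Poisson structure on $\mathbb{C}[X_{ij}]$ is called real if, after the change of coordinates $X_{ij}=R_{ij}+\sqrt{-1}\,I_{ij}$, $X_{ji}=R_{ij}-\sqrt{-1}\,I_{ij}$ for $i<j$ (with $X_{ii}$ kept as a real coordinate, and correspondingly $\partial/\partial X_{ij}=\frac12(\partial/\partial R_{ij}-\sqrt{-1}\,\partial/\partial I_{ij})$,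 $\partial/\partial X_{ji}=\frac12(\partial/\partial R_{ij}+\sqrt{-1}\,\partial/\partial I_{ij})$), its bivector has no imaginary part, i.e. the brackets of the coordinates $X_{ii},R_{ij},I_{ij}$ $(i<j)$ are polynomials in these coordinates with real coefficients. Such a bracket determines a Poisson structure on $\mathbb{R}^{k^2}$. *)

theory Defs
  imports "HOL-Analysis.Analysis" "HOL-Library.Poly_Mapping"
begin

section \<open>Polynomial rings\<close>

type_synonym 'v exponent = "'v \<Rightarrow>\<^sub>0 nat"

text \<open>The polynomial ring over \<open>'a\<close> in the variables \<open>'v\<close> is the monoid algebra of the
  exponents, i.e. finitely supported functions with the convolution product.\<close>
type_synonym ('v, 'a) mpoly = "'v exponent \<Rightarrow>\<^sub>0 'a"

definition Const :: "'a \<Rightarrow> ('v, 'a :: zero) mpoly" where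
  "Const c = Poly_Mapping.single 0 c"

definition Var :: "'v \<Rightarrow> ('v, 'a :: zero_neq_one) mpoly" where
  "Var v = Poly_Mapping.single (Poly_Mapping.single v 1) 1"

text \<open>Substitution of \<open>x v\<close> for the variable \<open>v\<close>, with coefficients mapped by \<open>\<phi>\<close>.\<close>
definition subst :: "('a \<Rightarrow> 'b) \<Rightarrow> ('v \<Rightarrow> 'b) \<Rightarrow> ('v, 'a :: zero) mpoly \<Rightarrow> 'b :: comm_semiring_1" where
  "subst \<phi> x p = (\<Sum>a\<in>Poly_Mapping.keys p.
     \<phi> (Poly_Mapping.lookup p a) * (\<Prod>v\<in>Poly_Mapping.keys a. x v ^ Poly_Mapping.lookup a v))"


section \<open>Poisson brackets\<close>

text \<open>Poisson brackets over the complex numbers on a subalgebra \<open>A\<close> of a polynomial ring.\<close>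
definition poisson_on :: "('v, complex) mpoly set \<Rightarrow>
    (('v, complex) mpoly \<Rightarrow> ('v, complex) mpoly \<Rightarrow> ('v, complex) mpoly) \<Rightarrow> bool" where
  "poisson_on A br \<longleftrightarrow>
     (\<forall>f\<in>A. \<forall>g\<in>A. br f g \<in> A) \<and>
     (\<forall>f\<in>A. \<forall>g\<in>A. \<forall>h\<in>A. br (f + g) h = br f h + br g h) \<and>
     (\<forall>c. \<forall>f\<in>A. \<forall>g\<in>A. br (Const c * f) g = Const c * br f g) \<and>
     (\<forall>f\<in>A. \<forall>g\<in>A. br f g = - br g f) \<and>
     (\<forall>f\<in>A. \<forall>g\<in>A. \<forall>h\<in>A. br (f * g) h = f * br g h + br f h * g) \<and>
     (\<forall>f\<in>A. \<forall>g\<in>A. \<forall>h\<in>A. br f (br g h) + br g (br h f) + br h (br f g) = 0)"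

text \<open>\<open>br\<close> on \<open>A\<close> and \<open>br'\<close> on \<open>B\<close> are related by \<open>F\<close>, for \<open>F\<close> mapping \<open>A\<close> to \<open>B\<close>.\<close>
definition poisson_related where
  "poisson_related F A br B br' \<longleftrightarrow>
     (\<forall>f\<in>A. F f \<in> B) \<and> (\<forall>f\<in>A. \<forall>g\<in>A. F (br f g) = br' (F f) (F g))"


section \<open>Minimal Hilbert bases\<close>

definition d :: "('k \<Rightarrow> nat) \<Rightarrow> 'k \<Rightarrow> nat" where
  "d n i = Gcd (n ` (UNIV - {i}))"

definition minimal_hilbert_basis :: "('k \<Rightarrow> nat) \<Rightarrow> bool" where
  "minimal_hilbert_basis n \<longleftrightarrow> (\<forall>i. n i = (\<Prod>j\<in>UNIV - {i}. d n j))"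


section \<open>The algebra of the monoid S and its bracket\<close>

datatype 'k zvar = Z 'k | Zbar 'k

definition monoid_S :: "('k :: finite \<Rightarrow> nat) \<Rightarrow> 'k zvar exponent set" where
  "monoid_S n = {a. (\<Sum>i\<in>UNIV. int (n i) *
     (int (Poly_Mapping.lookup a (Z i)) - int (Poly_Mapping.lookup a (Zbar i)))) = 0}"

definition algebra_S :: "('k :: finite \<Rightarrow> nat) \<Rightarrow> ('k zvar, complex) mpoly set" where
  "algebra_S n = {p. Poly_Mapping.keys p \<subseteq> monoid_S n}"

text \<open>Subtraction of exponents is truncated, but whenever the coefficient below is nonzero, both
  \<open>Z i\<close> and \<open>Zbar j\<close> have positive exponent in \<open>a + b\<close>.\<close>
definition monomial_bracket ::
    "real^'k^'k \<Rightarrow> 'k zvar exponent \<Rightarrow> 'k zvar exponent \<Rightarrow> ('k :: finite zvar, complex) mpoly" where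
  "monomial_bracket \<epsilon> a b = (\<Sum>i\<in>UNIV. \<Sum>j\<in>UNIV.
     Poly_Mapping.single
       (a + b - Poly_Mapping.single (Z i) 1 - Poly_Mapping.single (Zbar j) 1)
       (- 2 * \<i> * of_real (\<epsilon> $ i $ j) *
          of_int (int (Poly_Mapping.lookup a (Z i)) * int (Poly_Mapping.lookup b (Zbar j))
                - int (Poly_Mapping.lookup a (Zbar j)) * int (Poly_Mapping.lookup b (Z i)))))"

text \<open>The bilinear extension, on all polynomials in \<open>Z i\<close>, \<open>Zbar i\<close>.\<close>
definition bracket_eps :: "real^'k^'k \<Rightarrow>
    ('k zvar, complex) mpoly \<Rightarrow> ('k zvar, complex) mpoly \<Rightarrow> ('k :: finite zvar, complex) mpoly" where
  "bracket_eps \<epsilon> p q = (\<Sum>a\<in>Poly_Mapping.keys p. \<Sum>b\<in>Poly_Mapping.keys q.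
     Const (Poly_Mapping.lookup p a * Poly_Mapping.lookup q b) * monomial_bracket \<epsilon> a b)"


section \<open>The homomorphism F\<close>

definition F :: "('k \<Rightarrow> nat) \<Rightarrow> ('k \<times> 'k, complex) mpoly \<Rightarrow> ('k zvar, complex) mpoly" where
  "F n = subst Const (\<lambda>(i, j). if i = j then Var (Z i) * Var (Zbar i)
                               else Var (Z i) ^ d n i * Var (Zbar j) ^ d n j)"


section \<open>Real Poisson structures\<close>

text \<open>The coordinates \<open>X\<^sub>i\<^sub>i\<close>, and for \<open>i < j\<close> the coordinates \<open>R\<^sub>i\<^sub>j\<close> (at index \<open>(i, j)\<close>) and
  \<open>I\<^sub>i\<^sub>j\<close> (at index \<open>(j, i)\<close>), obtained by solving \<open>X\<^sub>i\<^sub>j = R\<^sub>i\<^sub>j + \<i> I\<^sub>i\<^sub>j\<close>, \<open>X\<^sub>j\<^sub>i = R\<^sub>i\<^sub>j - \<i> I\<^sub>i\<^sub>j\<close>.\<close>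
definition real_coord :: "'k :: linorder \<times> 'k \<Rightarrow> ('k \<times> 'k, complex) mpoly" where
  "real_coord = (\<lambda>(i, j).
     if i = j then Var (i, i)
     else if i < j then Const (1 / 2) * (Var (i, j) + Var (j, i))
     else Const (1 / (2 * \<i>)) * (Var (j, i) - Var (i, j)))"

definition real_polys :: "('k :: linorder \<times> 'k, complex) mpoly set" where
  "real_polys = range (\<lambda>p :: ('k \<times> 'k, real) mpoly. subst (\<lambda>r. Const (of_real r)) real_coord p)"

definition real_bracket :: "(('k :: linorder \<times> 'k, complex) mpoly \<Rightarrow>
    ('k \<times> 'k, complex) mpoly \<Rightarrow> ('k \<times> 'k, complex) mpoly) \<Rightarrow> bool" where
  "real_bracket br \<longleftrightarrow> (\<forall>u v. br (real_coord u) (real_coord v) \<in> real_polys)"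


section \<open>Well-definedness\<close>

abbreviation mon :: "'v exponent \<Rightarrow> 'a \<Rightarrow> ('v, 'a :: zero) mpoly" where
  "mon \<equiv> Poly_Mapping.single"

lemma mpoly_eq_sum: "(\<Sum>a\<in>Poly_Mapping.keys p. mon a (Poly_Mapping.lookup p a)) = p"
  for p :: "('v, 'a :: comm_monoid_add) mpoly"
  by (rule poly_mapping_eqI)
    (auto simp: lookup_sum lookup_single when_def in_keys_iff sum.delta)

lemma mpoly_induct [case_names add mon]:
  fixes p :: "('v, 'a :: comm_monoid_add) mpoly"
  assumes add: "\<And>p q. P p \<Longrightarrow> P q \<Longrightarrow> P (p + q)" and mon: "\<And>a c. P (mon a c)"
  shows "P p"
proof -
  have "P (\<Sum>a\<in>A. mon a (Poly_Mapping.lookup p a))" if "finite A" for A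
    using that
  proof induction
    case empty
    show ?case using mon[of 0 0] by simp
  next
    case (insert a A)
    then show ?case by (simp add: add mon)
  qed
  from this[of "Poly_Mapping.keys p"] show ?thesis by (simp add: mpoly_eq_sum)
qed

lemma linear_extension:
  fixes g :: "'v exponent \<Rightarrow> 'a :: comm_monoid_add \<Rightarrow> 'b :: comm_monoid_add"
  assumes g0: "\<And>a. g a 0 = 0" and g_add: "\<And>a c c'. g a (c + c') = g a c + g a c'"
  defines "L \<equiv> \<lambda>p :: ('v, 'a) mpoly. \<Sum>a\<in>Poly_Mapping.keys p. g a (Poly_Mapping.lookup p a)"
  shows linear_extension_add: "L (p + q) = L p + L q"
    and linear_extension_monom: "L (mon a c) = g a c"
proof -
  have L: "L p = (\<Sum>a\<in>A. g a (Poly_Mapping.lookup p a))"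
    if "finite A" "Poly_Mapping.keys p \<subseteq> A" for p A
    unfolding L_def using that by (intro sum.mono_neutral_left) (auto simp: in_keys_iff g0)
  let ?A = "Poly_Mapping.keys p \<union> Poly_Mapping.keys q"
  show "L (p + q) = L p + L q"
    using Poly_Mapping.keys_add[of p q]
    by (simp add: L[of ?A] lookup_add g_add sum.distrib)
  show "L (mon a c) = g a c"
    by (simp add: L[of "{a}"])
qed

lemma Const_add: "Const (c + c') = Const c + Const c'"
  by (simp add: Const_def single_add)

lemma Const_mult: "Const (c * c') = Const c * (Const c' :: ('v, 'a :: comm_semiring_1) mpoly)"
  by (simp add: Const_def mult_single)

lemma Const_0 [simp]: "Const 0 = 0" and Const_1 [simp]: "Const 1 = 1"
  by (simp_all add: Const_def)

lemma Const_times_monom: "Const c * mon a c' = mon a (c * c' :: 'a :: comm_semiring_1)"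
  by (simp add: Const_def mult_single)

lemma monom_0: "mon 0 c = Const c"
  by (simp add: Const_def)

lemma mpoly_generators_induct [case_names add mult Const Var]:
  fixes p :: "('v, 'a :: comm_semiring_1) mpoly"
  assumes add: "\<And>p q. P p \<Longrightarrow> P q \<Longrightarrow> P (p + q)" and mult: "\<And>p q. P p \<Longrightarrow> P q \<Longrightarrow> P (p * q)"
    and Const: "\<And>c. P (Const c)" and Var: "\<And>v. P (Var v)"
  shows "P p"
proof (induction p rule: mpoly_induct)
  case (mon a c)
  have pow: "P (mon (Poly_Mapping.single v k) 1)" for v k
  proof (induction k)
    case 0
    show ?case using Const[of 1] by (simp flip: monom_0)
  next
    case (Suc k)
    have "mon (Poly_Mapping.single v (Suc k)) (1 :: 'a)
        = Var v * mon (Poly_Mapping.single v k) 1"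
      by (simp add: Var_def mult_single flip: single_add)
    then show ?case using mult[OF Var Suc] by simp
  qed
  have "P (mon a 1)" for a
  proof -
    have "P (mon (\<Sum>v\<in>V. Poly_Mapping.single v (Poly_Mapping.lookup a v)) 1)"
      if "finite V" for V
      using that
    proof induction
      case empty
      show ?case using Const[of 1] by (simp add: monom_0)
    next
      case (insert v V)
      then show ?case using mult[OF pow insert.IH] by (simp add: mult_single)
    qed
    moreover have "(\<Sum>v\<in>Poly_Mapping.keys a. Poly_Mapping.single v (Poly_Mapping.lookup a v)) = a"
      by (rule poly_mapping_eqI)
        (auto simp: lookup_sum lookup_single when_def in_keys_iff sum.delta)
    ultimately show ?thesis by (metis finite_keys)
  qed
  from mult[OF Const[of c] this[of a]] show ?case by (simp add: Const_times_monom)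
qed (rule add)

context
  fixes \<phi> :: "'a :: comm_semiring_1 \<Rightarrow> 'b :: comm_semiring_1"
  assumes \<phi>: "\<phi> 0 = 0" "\<phi> 1 = 1" "\<And>c c'. \<phi> (c + c') = \<phi> c + \<phi> c'"
    "\<And>c c'. \<phi> (c * c') = \<phi> c * \<phi> c'"
begin

lemma subst_add: "subst \<phi> x (p + q) = subst \<phi> x p + subst \<phi> x q"
  unfolding subst_def by (rule linear_extension_add) (simp_all add: \<phi> algebra_simps)

lemma subst_monom:
  "subst \<phi> x (mon a c) = \<phi> c * (\<Prod>v\<in>Poly_Mapping.keys a. x v ^ Poly_Mapping.lookup a v)"
  unfolding subst_def by (rule linear_extension_monom) (simp_all add: \<phi> algebra_simps)

lemma subst_Const: "subst \<phi> x (Const c) = \<phi> c"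
  by (simp add: subst_monom flip: monom_0)

lemma subst_Var: "subst \<phi> x (Var v) = x v"
  by (simp add: subst_monom Var_def \<phi>)

lemma subst_mult: "subst \<phi> x (p * q) = subst \<phi> x p * subst \<phi> x q"
proof (induction p rule: mpoly_induct)
  case (mon a c)
  show ?case
  proof (induction q rule: mpoly_induct)
    case (mon b c')
    have prod: "(\<Prod>v\<in>Poly_Mapping.keys a. x v ^ Poly_Mapping.lookup a v)
        = (\<Prod>v\<in>V. x v ^ Poly_Mapping.lookup a v)"
      if "finite V" "Poly_Mapping.keys a \<subseteq> V" for a V
      using that by (intro prod.mono_neutral_left) (auto simp: in_keys_iff)
    let ?V = "Poly_Mapping.keys a \<union> Poly_Mapping.keys b"
    have ab: "(\<Prod>v\<in>Poly_Mapping.keys (a + b). x v ^ Poly_Mapping.lookup (a + b) v)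
        = (\<Prod>v\<in>?V. x v ^ Poly_Mapping.lookup (a + b) v)"
      using Poly_Mapping.keys_add[of a b] by (intro prod) simp_all
    show ?case
      unfolding mult_single subst_monom ab
      by (simp add: \<phi> prod[of ?V a] prod[of ?V b] lookup_add power_add prod.distrib ac_simps)
  qed (simp add: subst_add algebra_simps)
qed (simp add: subst_add algebra_simps)

end

text \<open>\<open>F n\<close> is an algebra homomorphism with values in \<open>algebra_S n\<close>.\<close>


lemma
  shows F_add: "F n (p + q) = F n p + F n q"
    and F_mult: "F n (p * q) = F n p * F n q"
    and F_Const: "F n (Const c) = Const c"
    and F_diag: "F n (Var (i, i)) = Var (Z i) * Var (Zbar i)"
    and F_off_diag: "i \<noteq> j \<Longrightarrow> F n (Var (i, j)) = Var (Z i) ^ d n i * Var (Zbar j) ^ d n j"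
  by (simp_all add: F_def subst_add subst_mult subst_Const subst_Var Const_add Const_mult)

lemma algebra_S_add: "p \<in> algebra_S n \<Longrightarrow> q \<in> algebra_S n \<Longrightarrow> p + q \<in> algebra_S n"
  using Poly_Mapping.keys_add[of p q] by (auto simp: algebra_S_def)

lemma algebra_S_sum: "(\<And>a. a \<in> A \<Longrightarrow> f a \<in> algebra_S n) \<Longrightarrow> sum f A \<in> algebra_S n"
  by (induction A rule: infinite_finite_induct)
    (simp_all add: algebra_S_add, simp_all add: algebra_S_def)

lemma monoid_S_add: "a \<in> monoid_S n \<Longrightarrow> b \<in> monoid_S n \<Longrightarrow> a + b \<in> monoid_S n"
  by (simp add: monoid_S_def lookup_add algebra_simps sum.distrib sum_subtractf)

lemma algebra_S_mult: "p \<in> algebra_S n \<Longrightarrow> q \<in> algebra_S n \<Longrightarrow> p * q \<in> algebra_S n"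
proof -
  assume "p \<in> algebra_S n" "q \<in> algebra_S n"
  then have "a + b \<in> monoid_S n" if "a \<in> Poly_Mapping.keys p" "b \<in> Poly_Mapping.keys q" for a b
    using that by (intro monoid_S_add) (auto simp: algebra_S_def)
  then show ?thesis
    using keys_mult[of p q] unfolding algebra_S_def by blast
qed

lemma algebra_S_Const: "Const c \<in> algebra_S n"
  by (auto simp: algebra_S_def Const_def monoid_S_def)

lemma Var_power: "(Var v :: ('v, 'a :: comm_semiring_1) mpoly) ^ m = mon (Poly_Mapping.single v m) 1"
  by (induction m) (simp_all add: Var_def mult_single flip: single_add)

lemma minimal_hilbert_basis_mult:
  fixes n :: "'k :: finite \<Rightarrow> nat"
  assumes "minimal_hilbert_basis n"
  shows "n i * d n i = (\<Prod>j\<in>UNIV. d n j)"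
proof -
  have "n i = (\<Prod>j\<in>UNIV - {i}. d n j)"
    using assms unfolding minimal_hilbert_basis_def by blast
  then show ?thesis
    using prod.remove[of UNIV i "d n"] by (metis finite UNIV_I mult.commute)
qed

lemma monom_in_algebra_S: "a \<in> monoid_S n \<Longrightarrow> mon a c \<in> algebra_S n"
  by (auto simp: algebra_S_def)

lemma pair_in_monoid_S:
  "Poly_Mapping.single (Z i) r + Poly_Mapping.single (Zbar j) s \<in> monoid_S n \<longleftrightarrow> n i * r = n j * s"
proof -
  have "(\<Sum>l\<in>UNIV. int (n l) * (int (Poly_Mapping.lookup (Poly_Mapping.single (Z i) r
          + Poly_Mapping.single (Zbar j) s) (Z l)) - int (Poly_Mapping.lookup
          (Poly_Mapping.single (Z i) r + Poly_Mapping.single (Zbar j) s) (Zbar l))))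
      = (\<Sum>l\<in>UNIV. (if l = i then int (n i * r) else 0) - (if l = j then int (n j * s) else 0))"
    by (rule sum.cong) (auto simp: lookup_add lookup_single when_def right_diff_distrib)
  then show ?thesis by (simp add: monoid_S_def sum_subtractf del: of_nat_mult)
qed

lemma F_in_algebra_S:
  fixes n :: "'k :: finite \<Rightarrow> nat"
  assumes "minimal_hilbert_basis n"
  shows "F n p \<in> algebra_S n"
proof (induction p rule: mpoly_generators_induct)
  case (Var v)
  obtain i j where v: "v = (i, j)" by fastforce
  have "Var (Z i) ^ r * Var (Zbar j) ^ s \<in> algebra_S n" if "n i * r = n j * s" for r s
    using that by (simp add: Var_power mult_single monom_in_algebra_S pair_in_monoid_S)
  from this[of 1 1] this[of "d n i" "d n j"] show ?case
    by (cases "i = j") (simp_all add: v F_diag F_off_diag minimal_hilbert_basis_mult[OF assms])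
qed (simp_all add: F_add F_mult F_Const algebra_S_add algebra_S_mult algebra_S_Const)

text \<open>\<open>bracket_eps \<epsilon>\<close> restricts to \<open>algebra_S n\<close>.\<close>

lemma equal_weights:
  fixes n :: "'k :: finite \<Rightarrow> nat"
  assumes "minimal_hilbert_basis n" "d n i = 1" "d n j = 1"
  shows "n i = n j"
  using minimal_hilbert_basis_mult[OF assms(1), of i] minimal_hilbert_basis_mult[OF assms(1), of j]
    assms(2,3) by simp

lemma monoid_S_cancel: "a + b \<in> monoid_S n \<Longrightarrow> b \<in> monoid_S n \<Longrightarrow> a \<in> monoid_S n"
  by (simp add: monoid_S_def lookup_add algebra_simps sum.distrib sum_subtractf)

lemma single_split:
  assumes "Poly_Mapping.lookup a v > 0"
  obtains a' where "a = a' + Poly_Mapping.single v (1 :: nat)"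
proof
  show "a = (a - Poly_Mapping.single v 1) + Poly_Mapping.single v 1"
    using assms by (intro poly_mapping_eqI) (auto simp: lookup_add lookup_minus lookup_single when_def)
qed

lemma monomial_bracket_in_algebra_S:
  assumes n: "minimal_hilbert_basis n"
    and \<epsilon>: "\<And>i j. \<not> (d n i = 1 \<and> d n j = 1) \<Longrightarrow> \<epsilon> $ i $ j = 0"
    and ab: "a \<in> monoid_S n" "b \<in> monoid_S n"
  shows "monomial_bracket \<epsilon> a b \<in> algebra_S n"
  unfolding monomial_bracket_def
proof (intro algebra_S_sum)
  fix i j
  let ?k = "int (Poly_Mapping.lookup a (Z i)) * int (Poly_Mapping.lookup b (Zbar j))
                - int (Poly_Mapping.lookup a (Zbar j)) * int (Poly_Mapping.lookup b (Z i))"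
  let ?a = "a + b - Poly_Mapping.single (Z i) 1 - Poly_Mapping.single (Zbar j) (1 :: nat)"
  show "mon ?a (- 2 * \<i> * of_real (\<epsilon> $ i $ j) * of_int ?k) \<in> algebra_S n"
  proof (cases "\<epsilon> $ i $ j = 0 \<or> ?k = 0")
    case True
    then have "- 2 * \<i> * of_real (\<epsilon> $ i $ j) * of_int ?k = (0 :: complex)"
      by (metis mult_zero_left mult_zero_right of_int_0 of_real_0)
    then show ?thesis by (simp add: algebra_S_def)
  next
    case False
    have eq: "n i = n j" using False \<epsilon> equal_weights[OF n] by metis
    have "Poly_Mapping.lookup (a + b) (Z i) > 0" "Poly_Mapping.lookup (a + b) (Zbar j) > 0"
      using False by (auto simp: lookup_add intro!: gr0I)
    then obtain c where c: "a + b = c + Poly_Mapping.single (Z i) 1" by (metis single_split)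
    then have "Poly_Mapping.lookup c (Zbar j) > 0"
      using \<open>Poly_Mapping.lookup (a + b) (Zbar j) > 0\<close> by (simp add: lookup_add lookup_single)
    then obtain c' where c': "c = c' + Poly_Mapping.single (Zbar j) 1" by (metis single_split)
    have "c' + (Poly_Mapping.single (Z i) 1 + Poly_Mapping.single (Zbar j) 1) \<in> monoid_S n"
      using monoid_S_add[OF ab] by (simp add: c c' ac_simps)
    then have "c' \<in> monoid_S n"
      by (rule monoid_S_cancel) (simp only: pair_in_monoid_S eq)
    moreover have "?a = c'" by (simp add: c c')
    ultimately show ?thesis by (simp only: monom_in_algebra_S)
  qed
qed

lemma bracket_eps_in_algebra_S:
  assumes "minimal_hilbert_basis n" "\<And>i j. \<not> (d n i = 1 \<and> d n j = 1) \<Longrightarrow> \<epsilon> $ i $ j = 0"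
    and "p \<in> algebra_S n" "q \<in> algebra_S n"
  shows "bracket_eps \<epsilon> p q \<in> algebra_S n"
  unfolding bracket_eps_def using assms
  by (intro algebra_S_sum algebra_S_mult algebra_S_Const monomial_bracket_in_algebra_S)
    (auto simp: algebra_S_def)

text \<open>\<open>bracket_eps \<epsilon>\<close> is a Poisson bracket.\<close>

lemma bracket_eps_add_left: "bracket_eps \<epsilon> (p + q) r = bracket_eps \<epsilon> p r + bracket_eps \<epsilon> q r"
  unfolding bracket_eps_def
  by (rule linear_extension_add[where g = "\<lambda>a c. \<Sum>b\<in>Poly_Mapping.keys r.
        Const (c * Poly_Mapping.lookup r b) * monomial_bracket \<epsilon> a b"])
    (simp_all add: distrib_right Const_add sum.distrib)

lemma bracket_eps_anticomm: "bracket_eps \<epsilon> q p = - bracket_eps \<epsilon> p q"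
proof -
  have anti: "monomial_bracket \<epsilon> b a = - monomial_bracket \<epsilon> a b" for a b
  proof -
    have neg: "mon e (h * of_int (k - l)) = - mon e (h * of_int (l - k))"
      for e :: "'a zvar exponent" and h :: complex and k l :: int
    proof -
      have "h * of_int (k - l) = - (h * of_int (l - k))" by (simp add: algebra_simps)
      then show ?thesis by (simp only: single_uminus)
    qed
    show ?thesis
      unfolding monomial_bracket_def sum_negf[symmetric] add.commute[of b a]
      by (rule sum.cong[OF refl], rule sum.cong[OF refl], subst neg) (simp only: mult.commute)
  qed
  show ?thesis
    unfolding bracket_eps_def sum_negf[symmetric]
    by (subst sum.swap, rule sum.cong[OF refl], rule sum.cong[OF refl], subst anti)
      (simp add: mult.commute)
qed

lemma bracket_eps_add_right: "bracket_eps \<epsilon> r (p + q) = bracket_eps \<epsilon> r p + bracket_eps \<epsilon> r q"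
  using bracket_eps_add_left[of \<epsilon> p q r] bracket_eps_anticomm[of \<epsilon> r] by simp

lemma bracket_eps_monom:
  "bracket_eps \<epsilon> (mon a c) (mon b c') = Const (c * c') * monomial_bracket \<epsilon> a b"
  by (simp add: bracket_eps_def)

lemma bracket_eps_Const_left: "bracket_eps \<epsilon> (Const c * p) q = Const c * bracket_eps \<epsilon> p q"
proof (induction p rule: mpoly_induct)
  case (mon a c')
  show ?case
  proof (induction q rule: mpoly_induct)
    case (mon b c'')
    show ?case by (simp only: Const_times_monom bracket_eps_monom Const_mult mult.assoc)
  qed (simp add: bracket_eps_add_right distrib_left)
qed (simp add: bracket_eps_add_left distrib_left)

lemma monomial_bracket_Leibniz:
  fixes a b c :: "'k :: finite zvar exponent"
  shows "monomial_bracket \<epsilon> (a + b) c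
    = mon a 1 * monomial_bracket \<epsilon> b c + monomial_bracket \<epsilon> a c * mon b 1"
proof -
  define K :: "'k zvar exponent \<Rightarrow> 'k zvar exponent \<Rightarrow> 'k \<Rightarrow> 'k \<Rightarrow> complex" where
    "K a b i j = - 2 * \<i> * of_real (\<epsilon> $ i $ j) *
          of_int (int (Poly_Mapping.lookup a (Z i)) * int (Poly_Mapping.lookup b (Zbar j))
                - int (Poly_Mapping.lookup a (Zbar j)) * int (Poly_Mapping.lookup b (Z i)))"
    for a b i j
  define E where "E i j = Poly_Mapping.single (Z i) 1 + Poly_Mapping.single (Zbar j) (1 :: nat)"
    for i j :: 'k
  have mb: "monomial_bracket \<epsilon> a b = (\<Sum>i\<in>UNIV. \<Sum>j\<in>UNIV. mon (a + b - E i j) (K a b i j))" for a b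
    by (simp add: monomial_bracket_def K_def E_def diff_diff_add)
  have shift: "mon c (1 :: complex) * mon (a + b - E i j) (K a b i j)
      = mon (c + a + b - E i j) (K a b i j)" for a b c i j
  proof (cases "K a b i j = 0")
    case False
    then have "Poly_Mapping.lookup (a + b) (Z i) > 0" "Poly_Mapping.lookup (a + b) (Zbar j) > 0"
      by (auto simp: K_def lookup_add intro!: gr0I)
    then have *: "a + b = (a + b - E i j) + E i j"
      by (intro poly_mapping_eqI)
        (auto simp: E_def lookup_add lookup_minus lookup_single when_def)
    have "c + a + b - E i j = c + (a + b - E i j) + E i j - E i j"
      unfolding add.assoc *[symmetric] ..
    then have "c + a + b - E i j = c + (a + b - E i j)"
      unfolding add_diff_cancel_right' .
    then show ?thesis by (simp add: mult_single)
  qed simp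
  have Kadd: "K (a + b) c i j = K b c i j + K a c i j" for i j
    by (simp add: K_def lookup_add algebra_simps)
  show ?thesis
    unfolding mult.commute[of "monomial_bracket \<epsilon> a c"]
    unfolding mb sum_distrib_left shift
    by (simp add: Kadd single_add sum.distrib add.commute add.left_commute)
qed

lemma bracket_eps_Leibniz:
  "bracket_eps \<epsilon> (p * q) r = p * bracket_eps \<epsilon> q r + bracket_eps \<epsilon> p r * q"
proof (induction p rule: mpoly_induct)
  case (mon a c)
  show ?case
  proof (induction q rule: mpoly_induct)
    case (mon b c')
    show ?case
    proof (induction r rule: mpoly_induct)
      case (mon e c'')
      have scale: "mon a c = Const c * mon a 1" for a and c :: complex
        by (simp add: Const_times_monom)
      show ?case
        unfolding mult_single bracket_eps_monom monomial_bracket_Leibniz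
        by (subst scale[of a c], subst scale[of b c']) (simp add: Const_mult algebra_simps)
    qed (simp add: bracket_eps_add_right algebra_simps)
  qed (simp add: bracket_eps_add_left algebra_simps)
qed (simp add: bracket_eps_add_left algebra_simps)

text \<open>The Jacobi identity of a biderivation holds if it holds for the variables.\<close>

lemma jacobi_generators:
  fixes br :: "('v, complex) mpoly \<Rightarrow> ('v, complex) mpoly \<Rightarrow> ('v, complex) mpoly"
  assumes add: "\<And>f g h. br (f + g) h = br f h + br g h"
    and Const: "\<And>c f g. br (Const c * f) g = Const c * br f g"
    and anti: "\<And>f g. br f g = - br g f"
    and Leibniz: "\<And>f g h. br (f * g) h = f * br g h + br f h * g"
    and Var: "\<And>u v w. br (Var u) (br (Var v) (Var w)) + br (Var v) (br (Var w) (Var u))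
                + br (Var w) (br (Var u) (Var v)) = 0"
  shows "br f (br g h) + br g (br h f) + br h (br f g) = 0"
proof -
  define J where "J f g h = br f (br g h) + br g (br h f) + br h (br f g)" for f g h
  have add': "br h (f + g) = br h f + br h g" for f g h
    by (metis add anti minus_add_distrib)
  have Leibniz': "br h (f * g) = f * br h g + br h f * g" for f g h
    using Leibniz[of f g h] anti[of h] anti[of h f] anti[of h g] by simp
  have br_0: "br 0 h = 0" "br h 0 = 0" for h
    using add[of 0 0 h] add'[of h 0 0] by simp_all
  have "br 1 h = 0" for h
    using Leibniz[of 1 1 h] by simp
  then have br_Const: "br (Const c) h = 0" "br h (Const c) = 0" for c h
    using Const[of c 1 h] anti[of h "Const c"] by simp_all
  have neg: "br h (- f) = - br h f" for f h
    using add'[of h f "- f"] by (simp add: br_0 eq_neg_iff_add_eq_0 add.commute)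
  have diff: "br h (f - g) = br h f - br h g" for f g h
    using add'[of h f "- g"] by (simp add: neg)
  have J_cyc: "J f g h = J g h f" for f g h
    by (simp add: J_def add.commute add.left_commute)
  have J_add: "J (f + f') g h = J f g h + J f' g h" for f f' g h
    by (simp add: J_def add add' algebra_simps)
  have J_mult: "J (f * f') g h = f * J f' g h + J f g h * f'" for f f' g h
    using anti[of f h] anti[of f' h] anti[of f g] anti[of f' g]
    by (simp add: J_def Leibniz Leibniz' add' neg diff algebra_simps)
  have J_Const: "J (Const c) g h = 0" for c g h
    by (simp add: J_def br_Const br_0)
  have J_ext: "J f g h = 0" if "\<And>u. J (Var u) g h = 0" for f g h
    by (induction f rule: mpoly_generators_induct)
      (simp_all add: J_add J_mult J_Const that)
  have "J f (Var v) (Var w) = 0" for f v w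
    by (rule J_ext) (simp add: J_def Var)
  then have "J f g (Var w) = 0" for f g w
    by (metis J_cyc J_ext)
  then have "J f g h = 0"
    by (metis J_cyc J_ext)
  then show ?thesis by (simp add: J_def)
qed

lemma bracket_eps_Var: "\<exists>c. bracket_eps \<epsilon> (Var u) (Var v) = Const c"
proof -
  have "\<exists>c. mon (Poly_Mapping.single u 1 + Poly_Mapping.single v 1
       - Poly_Mapping.single (Z i) 1 - Poly_Mapping.single (Zbar j) (1 :: nat))
       (- 2 * \<i> * of_real (\<epsilon> $ i $ j) * of_int
         (int (Poly_Mapping.lookup (Poly_Mapping.single u 1) (Z i))
            * int (Poly_Mapping.lookup (Poly_Mapping.single v 1) (Zbar j))
          - int (Poly_Mapping.lookup (Poly_Mapping.single u 1) (Zbar j))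
            * int (Poly_Mapping.lookup (Poly_Mapping.single v 1) (Z i)))) = (Const c :: ('a zvar, complex) mpoly)"
    (is "\<exists>c. ?M i j = _") for i j
  proof (cases "u = Z i \<and> v = Zbar j \<or> u = Zbar j \<and> v = Z i")
    case True
    then have "Poly_Mapping.single u 1 + Poly_Mapping.single v 1
       - Poly_Mapping.single (Z i) 1 - Poly_Mapping.single (Zbar j) (1 :: nat) = 0"
      by (auto simp: diff_diff_add add.commute)
    then show ?thesis by (metis monom_0)
  next
    case False
    then have "?M i j = 0" by (auto simp: lookup_single when_def)
    then show ?thesis by (metis Const_0)
  qed
  then obtain c where c: "?M i j = Const (c i j)" for i j by metis
  have Const_sum: "(\<Sum>i\<in>A. Const (g i)) = Const (sum g A)" for g :: "'a \<Rightarrow> complex" and A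
    by (induction A rule: infinite_finite_induct) (simp_all add: Const_add)
  show ?thesis
    unfolding Var_def bracket_eps_monom monomial_bracket_def c Const_sum Const_mult[symmetric]
    by blast
qed

lemma poisson_on_algebra_S:
  assumes "minimal_hilbert_basis n" "\<And>i j. \<not> (d n i = 1 \<and> d n j = 1) \<Longrightarrow> \<epsilon> $ i $ j = 0"
  shows "poisson_on (algebra_S n) (bracket_eps \<epsilon>)"
proof -
  have "bracket_eps \<epsilon> 1 h = 0" for h
    using bracket_eps_Leibniz[of \<epsilon> 1 1 h] by simp
  then have "bracket_eps \<epsilon> h (Const c) = 0" for h c
    using bracket_eps_Const_left[of \<epsilon> c 1 h] bracket_eps_anticomm[of \<epsilon> h "Const c"] by simp
  then have "bracket_eps \<epsilon> (Var u) (bracket_eps \<epsilon> (Var v) (Var w)) = 0" for u v w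
    using bracket_eps_Var[of \<epsilon> v w] by auto
  then have vars: "bracket_eps \<epsilon> (Var u) (bracket_eps \<epsilon> (Var v) (Var w))
      + bracket_eps \<epsilon> (Var v) (bracket_eps \<epsilon> (Var w) (Var u))
      + bracket_eps \<epsilon> (Var w) (bracket_eps \<epsilon> (Var u) (Var v)) = 0" for u v w
    by simp
  have jacobi: "bracket_eps \<epsilon> f (bracket_eps \<epsilon> g h) + bracket_eps \<epsilon> g (bracket_eps \<epsilon> h f)
      + bracket_eps \<epsilon> h (bracket_eps \<epsilon> f g) = 0" for f g h
    by (rule jacobi_generators[of "bracket_eps \<epsilon>", OF bracket_eps_add_left bracket_eps_Const_left
          bracket_eps_anticomm bracket_eps_Leibniz vars])
  show ?thesis
    unfolding poisson_on_def
    by (intro conjI ballI allI bracket_eps_in_algebra_S[OF assms])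
      (rule bracket_eps_add_left bracket_eps_Const_left bracket_eps_anticomm bracket_eps_Leibniz
        jacobi | assumption)+
qed

end

theory Submission
  imports Defs
begin

text \<open>
  Put \<open>w\<^sub>i = z\<^sub>i ^ d\<^sub>i\<close> and let \<open>Y\<^sub>i\<^sub>j\<close> be \<open>X\<^sub>i\<^sub>j\<close> for \<open>i \<noteq> j\<close> and \<open>X\<^sub>i\<^sub>i ^ d\<^sub>i\<close> for \<open>i = j\<close>, so that
  \<open>F\<close> sends every \<open>Y\<^sub>i\<^sub>j\<close> to \<open>w\<^sub>i\<close> times the conjugate of \<open>w\<^sub>j\<close>. The lift is the biderivation with
    \<open>{X\<^sub>i\<^sub>j, X\<^sub>l\<^sub>m} = - 2 \<i> (\<epsilon>\<^sub>i\<^sub>m Y\<^sub>l\<^sub>j - \<epsilon>\<^sub>l\<^sub>j Y\<^sub>i\<^sub>m)\<close>.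
  Two things could spoil this formula: derivatives of the powers \<open>z\<^sub>i ^ d\<^sub>i\<close> produce extra factors, and
  the right-hand side contains \<open>Y\<close> instead of \<open>X\<close>. Neither does, because \<open>\<epsilon>\<^sub>i\<^sub>j\<close> vanishes unless
  \<open>d\<^sub>i = d\<^sub>j = 1\<close>: a variable with \<open>d\<^sub>i > 1\<close> never contributes a derivative, and an \<open>X\<^sub>i\<^sub>i\<close> with
  \<open>d\<^sub>i > 1\<close> is a Casimir.

  If all \<open>d\<^sub>i\<close> are \<open>1\<close>, the bracket is, up to the factor \<open>2 \<i>\<close>, the Lie-Poisson bracket of the
  matrix commutator \<open>A \<epsilon> B - B \<epsilon> A\<close>. In general the Jacobi identity still reduces to this linear
  computation, since \<open>{X\<^sub>i\<^sub>j, Y\<^sub>l\<^sub>m}\<close> is given by the same formula as \<open>{X\<^sub>i\<^sub>j, X\<^sub>l\<^sub>m}\<close>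
  (\<open>lifted_bracket_Var_weight_product\<close>).

  Both remaining properties say that some ring homomorphism is compatible with brackets, and by the
  Leibniz rule this needs to be checked on variables only (\<open>biderivation_morphism\<close>). For the
  relation to \<open>{,}\<^sub>\<epsilon>\<close> the homomorphism is \<open>F\<close>. For reality it is the conjugate-linear involution
  exchanging \<open>X\<^sub>i\<^sub>j\<close> and \<open>X\<^sub>j\<^sub>i\<close>: its fixed points are exactly the real polynomials in the real
  coordinates, and it preserves the bracket because \<open>\<epsilon>\<close> is real and symmetric.
\<close>


section \<open>Biderivations\<close>

lemma Const_uminus: "Const (- c) = - (Const c :: ('v, complex) mpoly)"
  by (simp add: Const_def single_uminus)

locale biderivation =
  fixes br :: "('v, complex) mpoly \<Rightarrow> ('v, complex) mpoly \<Rightarrow> ('v, complex) mpoly"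
  assumes add_left: "br (f + g) h = br f h + br g h"
    and Const_mult_left: "br (Const c * f) g = Const c * br f g"
    and anticomm: "br f g = - br g f"
    and Leibniz_left: "br (f * g) h = f * br g h + br f h * g"
begin

lemma add_right: "br h (f + g) = br h f + br h g"
  by (metis add_left anticomm minus_add_distrib)

lemma Leibniz_right: "br h (f * g) = f * br h g + br h f * g"
  using Leibniz_left[of f g h] anticomm[of h] by simp

lemma Const_mult_right: "br f (Const c * g) = Const c * br f g"
  using Const_mult_left[of c g f] anticomm[of f] by simp

lemma Const_left: "br (Const c) h = 0"
proof -
  have "br 1 h = 0"
    using Leibniz_left[of 1 1 h] by simp
  then show ?thesis
    using Const_mult_left[of c 1 h] by simp
qed

lemma Const_right: "br h (Const c) = 0"
  using Const_left[of c h] anticomm[of h] by simp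

lemma uminus_right: "br h (- f) = - br h f"
  using Const_mult_right[of h "- 1" f] by (simp add: Const_uminus)

lemma diff_right: "br h (f - g) = br h f - br h g"
  using add_right[of h f "- g"] by (simp add: uminus_right)

lemma power_left_eq_0: "br f g = 0 \<Longrightarrow> br (f ^ m) g = 0"
proof (induction m)
  case 0
  show ?case using Const_left[of 1 g] by simp
qed (simp add: Leibniz_left)

lemma power_right_eq_0: "br f g = 0 \<Longrightarrow> br f (g ^ m) = 0"
  by (metis anticomm neg_0_equal_iff_equal power_left_eq_0)

end

lemma biderivation_bracket_eps: "biderivation (bracket_eps \<epsilon>)"
  by unfold_locales (rule bracket_eps_add_left bracket_eps_Const_left bracket_eps_anticomm
    bracket_eps_Leibniz)+

text \<open>Both sides are, in each argument separately, derivations along \<open>\<Phi>\<close> that vanish on constants,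
  so they are determined by their values on variables. Constants may be moved by \<open>\<Phi>\<close>,
  so that conjugate-linear ring homomorphisms are covered.\<close>
lemma biderivation_morphism:
  fixes \<Phi> :: "('v, complex) mpoly \<Rightarrow> ('w, complex) mpoly"
  assumes A: "biderivation A" and B: "biderivation B"
    and add: "\<And>f g. \<Phi> (f + g) = \<Phi> f + \<Phi> g"
    and mult: "\<And>f g. \<Phi> (f * g) = \<Phi> f * \<Phi> g"
    and Const: "\<And>c. \<Phi> (Const c) \<in> range Const"
    and Var: "\<And>u v. \<Phi> (A (Var u) (Var v)) = B (\<Phi> (Var u)) (\<Phi> (Var v))"
  shows "\<Phi> (A f g) = B (\<Phi> f) (\<Phi> g)"
proof -
  interpret A: biderivation A by (rule A)
  interpret B: biderivation B by (rule B)
  have zero: "\<Phi> 0 = 0"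
    using add[of 0 0] by simp
  have Const_B: "B (\<Phi> (Const c)) h = 0" "B h (\<Phi> (Const c)) = 0" for c h
    using Const[of c] B.Const_left B.Const_right by auto
  have "\<Phi> (A (Var u) g) = B (\<Phi> (Var u)) (\<Phi> g)" for u
    by (induction g rule: mpoly_generators_induct)
      (simp_all add: A.add_right B.add_right A.Leibniz_right B.Leibniz_right A.Const_right
        Const_B add mult zero Var)
  then show ?thesis
    by (induction f rule: mpoly_generators_induct)
      (simp_all add: A.add_left B.add_left A.Leibniz_left B.Leibniz_left A.Const_left
        Const_B add mult zero)
qed


section \<open>Brackets with prescribed values on the variables\<close>

definition partial_deriv :: "'v \<Rightarrow> ('v, complex) mpoly \<Rightarrow> ('v, complex) mpoly" where
  "partial_deriv v p = (\<Sum>a\<in>Poly_Mapping.keys p.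
     mon (a - Poly_Mapping.single v 1) (Poly_Mapping.lookup p a * of_nat (Poly_Mapping.lookup a v)))"

lemma partial_deriv_add: "partial_deriv v (p + q) = partial_deriv v p + partial_deriv v q"
  unfolding partial_deriv_def by (rule linear_extension_add) (simp_all add: distrib_right single_add)

lemma partial_deriv_monom:
  "partial_deriv v (mon a c) = mon (a - Poly_Mapping.single v 1) (c * of_nat (Poly_Mapping.lookup a v))"
  unfolding partial_deriv_def by (rule linear_extension_monom) (simp_all add: distrib_right single_add)

lemma partial_deriv_Const: "partial_deriv v (Const c) = 0"
  by (simp add: partial_deriv_monom flip: monom_0)

lemma partial_deriv_Var: "partial_deriv v (Var u) = (if u = v then 1 else 0)"
  by (simp add: Var_def partial_deriv_monom lookup_single)

text \<open>Checked on monomials, where it says that \<open>lookup (a + b) v = lookup a v + lookup b v\<close>.\<close>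
lemma partial_deriv_mult: "partial_deriv v (p * q) = p * partial_deriv v q + partial_deriv v p * q"
proof (induction p rule: mpoly_induct)
  case (mon a c)
  show ?case
  proof (induction q rule: mpoly_induct)
    case (mon b c')
    let ?e = "Poly_Mapping.single v (1 :: nat)"
    \<comment> \<open>Truncation of \<open>a - ?e\<close> occurs only where the factor \<open>lookup a v\<close> vanishes.\<close>
    have shift: "mon (a + b - ?e) (s * of_nat (Poly_Mapping.lookup a v))
        = mon (a - ?e + b) (s * of_nat (Poly_Mapping.lookup a v))"
      for a b and s :: complex
    proof (cases "Poly_Mapping.lookup a v = 0")
      case False
      then have "a + b - ?e = a - ?e + b"
        by (intro poly_mapping_eqI) (auto simp: lookup_add lookup_minus lookup_single when_def)
      then show ?thesis by simp
    qed simp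
    have "partial_deriv v (mon a c * mon b c')
        = mon (a + b - ?e) (c * c' * of_nat (Poly_Mapping.lookup a v))
          + mon (b + a - ?e) (c * c' * of_nat (Poly_Mapping.lookup b v))"
      by (simp add: mult_single partial_deriv_monom lookup_add distrib_left single_add add.commute)
    then show ?case
      unfolding shift by (simp add: mult_single partial_deriv_monom ac_simps)
  qed (simp add: partial_deriv_add distrib_left distrib_right add.left_commute add.assoc)
qed (simp add: partial_deriv_add distrib_left distrib_right add.left_commute add.assoc)

text \<open>The bivector with coefficients \<open>P\<close> contracted with the differentials of \<open>f\<close> and \<open>g\<close>.\<close>
definition structure_bracket ::
    "('v \<Rightarrow> 'v \<Rightarrow> ('v :: finite, complex) mpoly) \<Rightarrow>
     ('v, complex) mpoly \<Rightarrow> ('v, complex) mpoly \<Rightarrow> ('v, complex) mpoly" where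
  "structure_bracket P f g = (\<Sum>u\<in>UNIV. \<Sum>v\<in>UNIV. P u v * (partial_deriv u f * partial_deriv v g))"

lemma structure_bracket_Var: "structure_bracket P (Var u) (Var v) = P u v"
proof -
  have "(\<Sum>t\<in>UNIV. P s t * (partial_deriv s (Var u) * partial_deriv t (Var v)))
      = (if s = u then P s v else 0)" for s
    by (simp add: partial_deriv_Var mult_delta_right)
  then show ?thesis
    by (simp add: structure_bracket_def)
qed

lemma biderivation_structure_bracket:
  assumes "\<And>u v. P u v = - P v u"
  shows "biderivation (structure_bracket P)"
proof
  fix f g h and c
  show "structure_bracket P (f + g) h = structure_bracket P f h + structure_bracket P g h"
    by (simp add: structure_bracket_def partial_deriv_add distrib_left distrib_right sum.distrib)
  show "structure_bracket P (f * g) h = f * structure_bracket P g h + structure_bracket P f h * g"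
    by (simp add: structure_bracket_def partial_deriv_mult sum_distrib_left sum_distrib_right
        algebra_simps sum.distrib)
  show "structure_bracket P (Const c * f) g = Const c * structure_bracket P f g"
    by (simp add: structure_bracket_def partial_deriv_mult partial_deriv_Const sum_distrib_left algebra_simps)
  show "structure_bracket P f g = - structure_bracket P g f"
    unfolding structure_bracket_def sum_negf[symmetric]
    by (subst sum.swap, rule sum.cong[OF refl], rule sum.cong[OF refl], subst assms)
      (simp add: mult.commute)
qed


section \<open>Real polynomials\<close>

text \<open>Complex conjugation on the real form in which \<open>X\<^sub>i\<^sub>j\<close> and \<open>X\<^sub>j\<^sub>i\<close> are conjugate to each other.\<close>
definition conj_swap :: "('k \<times> 'k, complex) mpoly \<Rightarrow> ('k \<times> 'k, complex) mpoly" where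
  "conj_swap = subst (\<lambda>c. Const (cnj c)) (\<lambda>(i, j). Var (j, i))"

lemma conj_swap_add: "conj_swap (p + q) = conj_swap p + conj_swap q"
  and conj_swap_mult: "conj_swap (p * q) = conj_swap p * conj_swap q"
  and conj_swap_Const: "conj_swap (Const c) = Const (cnj c)"
  and conj_swap_Var: "conj_swap (Var (i, j)) = Var (j, i)"
  by (simp_all add: conj_swap_def subst_add subst_mult subst_Const subst_Var Const_add Const_mult)

lemma conj_swap_uminus: "conj_swap (- p) = - conj_swap p"
  using conj_swap_mult[of "Const (- 1)" p] unfolding conj_swap_Const by (simp add: Const_uminus)

lemma conj_swap_diff: "conj_swap (p - q) = conj_swap p - conj_swap q"
  using conj_swap_add[of p "- q"] by (simp add: conj_swap_uminus)

lemma conj_swap_power: "conj_swap (p ^ m) = conj_swap p ^ m"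
proof (induction m)
  case 0
  show ?case using conj_swap_Const[of 1] by simp
qed (simp add: conj_swap_mult)

lemma conj_swap_real_coord: "conj_swap (real_coord u) = real_coord u"
proof (cases u)
  case (Pair i j)
  have "Const (cnj (1 / (2 * \<i>))) = - (Const (1 / (2 * \<i>)) :: ('a \<times> 'a, complex) mpoly)"
    by (simp flip: Const_uminus)
  then show ?thesis
    unfolding Pair real_coord_def
    by (simp add: conj_swap_Var conj_swap_mult conj_swap_add conj_swap_diff conj_swap_Const
        algebra_simps)
qed

lemma
  fixes \<phi> :: "('k :: linorder \<times> 'k, real) mpoly \<Rightarrow> ('k \<times> 'k, complex) mpoly"
  defines "\<phi> \<equiv> subst (\<lambda>r. Const (of_real r)) real_coord"
  shows real_param_add: "\<phi> (p + q) = \<phi> p + \<phi> q"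
    and real_param_mult: "\<phi> (p * q) = \<phi> p * \<phi> q"
    and real_param_Const: "\<phi> (Const r) = Const (of_real r)"
    and real_param_Var: "\<phi> (Var u) = real_coord u"
  by (simp_all add: \<phi>_def subst_add subst_mult subst_Const subst_Var Const_add Const_mult)

lemma real_polys_add: "p \<in> real_polys \<Longrightarrow> q \<in> real_polys \<Longrightarrow> p + q \<in> real_polys"
  unfolding real_polys_def by (auto simp flip: real_param_add)

lemma real_polys_mult: "p \<in> real_polys \<Longrightarrow> q \<in> real_polys \<Longrightarrow> p * q \<in> real_polys"
  unfolding real_polys_def by (auto simp flip: real_param_mult)

lemma real_polys_Const: "Const (of_real r) \<in> real_polys"
  unfolding real_polys_def by (rule range_eqI[where x = "Const r"]) (simp only: real_param_Const)

lemma real_polys_coord: "real_coord u \<in> real_polys"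
  unfolding real_polys_def by (rule range_eqI[where x = "Var u"]) (simp only: real_param_Var)

lemma real_polys_uminus: "p \<in> real_polys \<Longrightarrow> - p \<in> real_polys"
  using real_polys_mult[OF real_polys_Const[of "- 1"], of p] by (simp add: Const_uminus)

lemma Const_ii_square: "Const \<i> * Const \<i> = (- 1 :: ('v, complex) mpoly)"
  by (simp add: Const_uminus flip: Const_mult)

text \<open>The real polynomials together with \<open>\<i>\<close> generate everything, since \<open>X\<^sub>i\<^sub>j = R\<^sub>i\<^sub>j + \<i> I\<^sub>i\<^sub>j\<close>.
  Since \<open>conj_swap\<close> fixes the coordinates and conjugates the constants, it acts on the decomposition
  as complex conjugation; carrying this through the induction makes \<open>p\<close> and \<open>q\<close> readable from \<open>f\<close> and
  \<open>conj_swap f\<close>.\<close>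
lemma real_imaginary_parts:
  "\<exists>p\<in>real_polys. \<exists>q\<in>real_polys. f = p + Const \<i> * q \<and> conj_swap f = p - Const \<i> * q"
proof (induction f rule: mpoly_generators_induct)
  case (add f f')
  then obtain p q p' q' where r: "p \<in> real_polys" "q \<in> real_polys" "p' \<in> real_polys" "q' \<in> real_polys"
    and f: "f = p + Const \<i> * q" "conj_swap f = p - Const \<i> * q"
    "f' = p' + Const \<i> * q'" "conj_swap f' = p' - Const \<i> * q'"
    by blast
  have "f + f' = (p + p') + Const \<i> * (q + q')"
    unfolding f(1,3) by (simp add: algebra_simps)
  moreover have "conj_swap (f + f') = (p + p') - Const \<i> * (q + q')"
    unfolding conj_swap_add f(2,4) by (simp add: algebra_simps)
  ultimately show ?case using r real_polys_add by blast
next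
  case (mult f f')
  then obtain p q p' q' where r: "p \<in> real_polys" "q \<in> real_polys" "p' \<in> real_polys" "q' \<in> real_polys"
    and f: "f = p + Const \<i> * q" "conj_swap f = p - Const \<i> * q"
    "f' = p' + Const \<i> * q'" "conj_swap f' = p' - Const \<i> * q'"
    by blast
  have "f * f' = p * p' + (Const \<i> * Const \<i>) * (q * q') + Const \<i> * (p * q' + q * p')"
    unfolding f(1,3) by (simp only: algebra_simps)
  then have "f * f' = (p * p' + - (q * q')) + Const \<i> * (p * q' + q * p')"
    unfolding Const_ii_square by simp
  moreover have "conj_swap (f * f')
      = p * p' + (Const \<i> * Const \<i>) * (q * q') - Const \<i> * (p * q' + q * p')"
    unfolding conj_swap_mult f(2,4) by (simp add: algebra_simps)
  then have "conj_swap (f * f') = (p * p' + - (q * q')) - Const \<i> * (p * q' + q * p')"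
    unfolding Const_ii_square by simp
  moreover have "p * p' + - (q * q') \<in> real_polys" "p * q' + q * p' \<in> real_polys"
    by (intro real_polys_add real_polys_mult real_polys_uminus r)+
  ultimately show ?case by blast
next
  case (Const c)
  have c: "of_real (Re c) + \<i> * of_real (Im c) = c"
    "of_real (Re c) + - \<i> * of_real (Im c) = cnj c"
    by (simp_all add: complex_eq_iff)
  have "Const c = Const (of_real (Re c)) + Const \<i> * Const (of_real (Im c))"
    by (simp only: c flip: Const_add Const_mult)
  moreover have "conj_swap (Const c) = Const (of_real (Re c)) - Const \<i> * Const (of_real (Im c))"
    unfolding conj_swap_Const c(2)[symmetric] by (simp only: Const_add Const_mult Const_uminus) simp
  ultimately show ?case using real_polys_Const by blast
next
  case (Var v)
  obtain i j where v: "v = (i, j)" by force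
  have half: "Const (1 / 2) * x + Const (1 / 2) * x = x" for x :: "('a \<times> 'a, complex) mpoly"
    by (simp flip: distrib_right Const_add)
  have eq: "Var (i, j) = real_coord (i, j) + Const \<i> * real_coord (j, i)"
    "Var (j, i) = real_coord (i, j) - Const \<i> * real_coord (j, i)" if "i < j" for i j :: 'a
  proof -
    have "Const \<i> * (Const (1 / (2 * \<i>)) * x) = Const (1 / 2) * x" for x :: "('a \<times> 'a, complex) mpoly"
      by (simp flip: mult.assoc Const_mult)
    moreover have ij: "i \<noteq> j" "\<not> j < i"
      using that by auto
    ultimately have c: "Const \<i> * real_coord (j, i) = Const (1 / 2) * (Var (i, j) - Var (j, i))"
      by (simp add: real_coord_def)
    have r: "real_coord (i, j) = Const (1 / 2) * (Var (i, j) + Var (j, i))"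
      using that ij by (simp add: real_coord_def)
    have "real_coord (i, j) + Const \<i> * real_coord (j, i)
        = Const (1 / 2) * Var (i, j) + Const (1 / 2) * Var (i, j)"
      unfolding c r by (simp add: algebra_simps)
    then show "Var (i, j) = real_coord (i, j) + Const \<i> * real_coord (j, i)"
      by (simp only: half)
    have "real_coord (i, j) - Const \<i> * real_coord (j, i)
        = Const (1 / 2) * Var (j, i) + Const (1 / 2) * Var (j, i)"
      unfolding c r by (simp add: algebra_simps)
    then show "Var (j, i) = real_coord (i, j) - Const \<i> * real_coord (j, i)"
      by (simp only: half)
  qed
  consider "i = j" | "i < j" | "j < i" by force
  then show ?case
  proof cases
    case 1
    have "Var v = real_coord v + Const \<i> * Const (of_real 0)"
      "conj_swap (Var v) = real_coord v - Const \<i> * Const (of_real 0)"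
      using 1 by (simp_all add: v conj_swap_Var real_coord_def)
    then show ?thesis using real_polys_coord real_polys_Const by blast
  next
    case 2
    then show ?thesis using eq[OF 2] real_polys_coord by (metis v conj_swap_Var)
  next
    case 3
    have "Var v = real_coord (j, i) + Const \<i> * (- real_coord (i, j))"
      "conj_swap (Var v) = real_coord (j, i) - Const \<i> * (- real_coord (i, j))"
      unfolding v conj_swap_Var using eq[OF 3] by simp_all
    then show ?thesis using real_polys_coord real_polys_uminus by metis
  qed
qed

text \<open>This turns reality of a bracket into an equation, which can be verified without writing the
  bracket in the coordinates \<open>R\<^sub>i\<^sub>j\<close>, \<open>I\<^sub>i\<^sub>j\<close>.\<close>
lemma conj_swap_fixed_imp_real:
  assumes "conj_swap f = f"
  shows "f \<in> real_polys"
proof -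
  obtain p q where pq: "p \<in> real_polys" "f = p + Const \<i> * q" "conj_swap f = p - Const \<i> * q"
    using real_imaginary_parts by blast
  then have "Const \<i> * q + Const \<i> * q = 0"
    using assms by (simp add: eq_diff_eq add.assoc)
  \<comment> \<open>Multiplication by the inverse of \<open>2 \<i>\<close>.\<close>
  then have "Const (- \<i> / 2) * (Const \<i> * q + Const \<i> * q) = 0"
    by simp
  then have "q = 0"
    by (simp flip: distrib_right mult.assoc Const_add Const_mult)
  then show ?thesis using pq by simp
qed


section \<open>The lifted bracket\<close>

text \<open>The polynomial called \<open>Y\<^sub>i\<^sub>j\<close> above: a preimage under \<open>F\<close> of \<open>z\<^sub>i ^ d\<^sub>i\<close> times the conjugate of
  \<open>z\<^sub>j ^ d\<^sub>j\<close>, for \<open>i = j\<close> as well.\<close>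
definition weight_product :: "('k \<Rightarrow> nat) \<Rightarrow> 'k \<Rightarrow> 'k \<Rightarrow> ('k \<times> 'k, complex) mpoly" where
  "weight_product n i j = (if i = j then Var (i, i) ^ d n i else Var (i, j))"

text \<open>The constant \<open>{z\<^sub>i, z\<^sub>j conjugate}\<^sub>\<epsilon>\<close>, in a polynomial ring in any variables, because it appears
  both in \<open>\<complex>[X]\<close> and in \<open>\<complex>[z, z conjugate]\<close>.\<close>
definition coupling :: "real^'k^'k \<Rightarrow> 'k \<Rightarrow> 'k \<Rightarrow> ('v, complex) mpoly" where
  "coupling \<epsilon> i j = Const (- 2 * \<i> * of_real (\<epsilon> $ i $ j))"

text \<open>Up to the factor \<open>2 \<i>\<close>, the structure constants of the commutator for the matrix product
  \<open>A \<epsilon>\<^sup>T B\<close>, with the linear coordinates \<open>X\<close> of the result replaced by \<open>Y\<close>.\<close>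
definition lifted_bracket :: "('k \<Rightarrow> nat) \<Rightarrow> real^'k^'k \<Rightarrow> ('k :: finite \<times> 'k, complex) mpoly \<Rightarrow>
    ('k \<times> 'k, complex) mpoly \<Rightarrow> ('k \<times> 'k, complex) mpoly" where
  "lifted_bracket n \<epsilon> = structure_bracket (\<lambda>(i, j) (l, m).
     coupling \<epsilon> i m * weight_product n l j - coupling \<epsilon> l j * weight_product n i m)"

lemma lifted_bracket_Var: "lifted_bracket n \<epsilon> (Var (i, j)) (Var (l, m))
    = coupling \<epsilon> i m * weight_product n l j - coupling \<epsilon> l j * weight_product n i m"
  by (simp add: lifted_bracket_def structure_bracket_Var)

lemma biderivation_lifted_bracket: "biderivation (lifted_bracket n \<epsilon>)"
  unfolding lifted_bracket_def by (rule biderivation_structure_bracket) auto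

context
  fixes n :: "'k :: finite \<Rightarrow> nat" and \<epsilon> :: "real^'k^'k"
  assumes \<epsilon>: "\<And>i j. \<not> (d n i = 1 \<and> d n j = 1) \<Longrightarrow> \<epsilon> $ i $ j = 0"
begin

lemma coupling_eq_0: "d n i \<noteq> 1 \<or> d n j \<noteq> 1 \<Longrightarrow> coupling \<epsilon> i j = 0"
  using \<epsilon>[of i j] by (auto simp: coupling_def)

text \<open>If \<open>Y\<^sub>l\<^sub>m\<close> is not \<open>X\<^sub>l\<^sub>m\<close>, then \<open>l = m\<close> and \<open>d\<^sub>l \<noteq> 1\<close>, so \<open>X\<^sub>l\<^sub>l\<close> is a Casimir and the couplings on the
  right are zero. Hence the bracket formula extends from \<open>X\<close> to \<open>Y\<close>, as double brackets require.\<close>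
lemma lifted_bracket_Var_weight_product: "lifted_bracket n \<epsilon> (Var (i, j)) (weight_product n l m)
    = coupling \<epsilon> i m * weight_product n l j - coupling \<epsilon> l j * weight_product n i m"
proof (cases "l = m \<and> d n l \<noteq> 1")
  case True
  then have "coupling \<epsilon> i m = (0 :: ('k \<times> 'k, complex) mpoly)"
    "coupling \<epsilon> l j = (0 :: ('k \<times> 'k, complex) mpoly)"
    by (auto intro: coupling_eq_0)
  moreover from this have "lifted_bracket n \<epsilon> (Var (i, j)) (Var (l, l)) = 0"
    using True by (simp add: lifted_bracket_Var)
  then have "lifted_bracket n \<epsilon> (Var (i, j)) (weight_product n l m) = 0"
    using True
    by (simp add: weight_product_def biderivation.power_right_eq_0[OF biderivation_lifted_bracket])
  ultimately show ?thesis by simp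
next
  case False
  then have "weight_product n l m = Var (l, m)" by (auto simp: weight_product_def)
  then show ?thesis by (simp add: lifted_bracket_Var)
qed

text \<open>Each double bracket of variables consists of four terms, a product of two couplings times some
  \<open>Y\<close>. In the cyclic sum the twelve terms cancel in pairs, exactly as they do for the commutator of
  the associative product \<open>A \<epsilon>\<^sup>T B\<close> of matrices.\<close>
lemma poisson_on_lifted_bracket: "poisson_on UNIV (lifted_bracket n \<epsilon>)"
proof -
  interpret biderivation "lifted_bracket n \<epsilon>" by (rule biderivation_lifted_bracket)
  have coupling_mult: "lifted_bracket n \<epsilon> f (coupling \<epsilon> i j * g)
      = coupling \<epsilon> i j * lifted_bracket n \<epsilon> f g" for f g i j
    by (simp add: coupling_def Const_mult_right)
  let ?b = "lifted_bracket n \<epsilon>"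
  have vars: "?b (Var u) (?b (Var v) (Var w)) + ?b (Var v) (?b (Var w) (Var u))
      + ?b (Var w) (?b (Var u) (Var v)) = 0" for u v w
    by (cases u; cases v; cases w)
      (simp only: lifted_bracket_Var diff_right coupling_mult lifted_bracket_Var_weight_product,
        simp add: algebra_simps)
  have jacobi: "?b f (?b g h) + ?b g (?b h f) + ?b h (?b f g) = 0" for f g h
    by (rule jacobi_generators[of ?b, OF add_left Const_mult_left anticomm Leibniz_left vars])
  show ?thesis
    unfolding poisson_on_def
    by (intro conjI ballI allI UNIV_I)
      (rule add_left Const_mult_left anticomm Leibniz_left jacobi)+
qed

end

text \<open>Conjugation changes the sign of \<open>- 2 \<i>\<close>, and swapping indices exchanges the two terms of the
  bracket up to transposing \<open>\<epsilon>\<close>.\<close>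
lemma conj_swap_lifted_bracket:
  assumes sym: "\<And>i j. \<epsilon> $ i $ j = \<epsilon> $ j $ i"
  shows "conj_swap (lifted_bracket n \<epsilon> f g) = lifted_bracket n \<epsilon> (conj_swap f) (conj_swap g)"
proof (rule biderivation_morphism[OF biderivation_lifted_bracket biderivation_lifted_bracket
      conj_swap_add conj_swap_mult])
  show "conj_swap (Const c) \<in> range Const" for c
    by (simp add: conj_swap_Const)
  have swap_weight_product: "conj_swap (weight_product n i j) = weight_product n j i" for i j
    by (simp add: weight_product_def conj_swap_Var conj_swap_power)
  have swap_coupling: "conj_swap (coupling \<epsilon> i j) = - coupling \<epsilon> j i" for i j
    using sym[of i j] by (simp add: coupling_def conj_swap_Const flip: Const_uminus)
  show "conj_swap (lifted_bracket n \<epsilon> (Var u) (Var v))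
      = lifted_bracket n \<epsilon> (conj_swap (Var u)) (conj_swap (Var v))" for u v
    by (cases u; cases v) (simp add: lifted_bracket_Var conj_swap_Var conj_swap_diff
        conj_swap_mult swap_weight_product swap_coupling)
qed

lemma F_power: "F n (p ^ m) = F n p ^ m"
proof (induction m)
  case 0
  show ?case using F_Const[of n 1] by simp
qed (simp add: F_mult)

lemma F_weight_product: "F n (weight_product n i j) = Var (Z i) ^ d n i * Var (Zbar j) ^ d n j"
  by (simp add: weight_product_def F_power F_diag F_off_diag power_mult_distrib)

lemma bracket_eps_Var_values:
  "bracket_eps \<epsilon> (Var (Z i)) (Var (Zbar j)) = coupling \<epsilon> i j"
  "bracket_eps \<epsilon> (Var (Z i)) (Var (Z j)) = 0"
  "bracket_eps \<epsilon> (Var (Zbar i)) (Var (Zbar j)) = 0"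
proof -
  let ?s = "\<lambda>v. Poly_Mapping.single v (1 :: nat)"
  have "monomial_bracket \<epsilon> (?s (Z i)) (?s (Zbar j))
      = (\<Sum>l\<in>UNIV. \<Sum>m\<in>UNIV. if l = i then if m = j then coupling \<epsilon> i j else 0 else 0)"
    unfolding monomial_bracket_def
    by (intro sum.cong refl)
      (auto simp: lookup_single when_def coupling_def diff_diff_add monom_0)
  also have "\<dots> = (\<Sum>l\<in>UNIV. if l = i then coupling \<epsilon> i j else 0)"
    by (intro sum.cong refl) simp
  finally show "bracket_eps \<epsilon> (Var (Z i)) (Var (Zbar j)) = coupling \<epsilon> i j"
    unfolding Var_def bracket_eps_monom by simp
  show "bracket_eps \<epsilon> (Var (Z i)) (Var (Z j)) = 0"
    "bracket_eps \<epsilon> (Var (Zbar i)) (Var (Zbar j)) = 0"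
    unfolding Var_def bracket_eps_monom
    by (simp_all add: monomial_bracket_def lookup_single)
qed

text \<open>\<open>F (X\<^sub>i\<^sub>j)\<close> is a product of powers of \<open>z\<^sub>i\<close> and of the conjugate of \<open>z\<^sub>j\<close> with exponents \<open>1\<close> on
  the diagonal and \<open>d\<^sub>i\<close>, \<open>d\<^sub>j\<close> off it. Wherever a coupling survives, the differentiated factors have
  exponent \<open>1\<close>, and the exponents of the remaining factors are \<open>d\<^sub>l\<close>, \<open>d\<^sub>j\<close>, even on the diagonal.\<close>
lemma F_lifted_bracket:
  assumes \<epsilon>: "\<And>i j. \<not> (d n i = 1 \<and> d n j = 1) \<Longrightarrow> \<epsilon> $ i $ j = 0"
  shows "F n (lifted_bracket n \<epsilon> f g) = bracket_eps \<epsilon> (F n f) (F n g)"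
proof (rule biderivation_morphism[OF biderivation_lifted_bracket biderivation_bracket_eps
      F_add F_mult])
  interpret biderivation "bracket_eps \<epsilon>" by (rule biderivation_bracket_eps)
  let ?b = "bracket_eps \<epsilon>" and ?K = "coupling \<epsilon>" and ?z = "\<lambda>i. Var (Z i)" and ?w = "\<lambda>i. Var (Zbar i)"
  show "F n (Const c) \<in> range Const" for c
    by (simp add: F_Const)
  have zz: "?b (?z i ^ r) (?z j ^ s) = 0" and ww: "?b (?w i ^ r) (?w j ^ s) = 0" for i j r s
    by (simp_all add: power_left_eq_0 power_right_eq_0 bracket_eps_Var_values)
  \<comment> \<open>The factor \<open>r * s\<close> and the lowered exponents expected from the power rule do not appear:
    either \<open>r = s = 1\<close> or the coupling vanishes.\<close>
  have zw: "?b (?z i ^ r) (?w j ^ s) = ?K i j"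
    if "r = 1 \<or> r = d n i" "s = 1 \<or> s = d n j" for i j r s
  proof (cases "d n i = 1 \<and> d n j = 1")
    case True
    with that show ?thesis by (auto simp: bracket_eps_Var_values)
  next
    case False
    then have "?K i j = (0 :: ('a zvar, complex) mpoly)"
      by (intro coupling_eq_0[of n \<epsilon> i j]) (use \<epsilon> in blast)+
    then show ?thesis
      by (simp add: power_left_eq_0 power_right_eq_0 bracket_eps_Var_values)
  qed
  have wz: "?b (?w j ^ s) (?z i ^ r) = - ?K i j"
    if "r = 1 \<or> r = d n i" "s = 1 \<or> s = d n j" for i j r s
    using zw[OF that] anticomm by metis
  define e where "e i j = (if i = j then 1 else d n i)" for i j :: 'a
  have e: "e i j = 1 \<or> e i j = d n i" for i j
    by (simp add: e_def)
  have F_Var: "F n (Var (i, j)) = ?z i ^ e i j * ?w j ^ e j i" for i j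
    by (simp add: e_def F_diag F_off_diag)
  \<comment> \<open>The diagonal exponent \<open>1\<close> in \<open>e l m\<close> agrees with \<open>d n l\<close>: then \<open>l = m\<close>, and the coupling
    forces \<open>d n m = 1\<close>.\<close>
  have K_weight_product: "?K i m * (?z l ^ e l m * ?w j ^ e j i)
      = ?K i m * F n (weight_product n l j)" for i j l m
  proof (cases "d n i = 1 \<and> d n m = 1")
    case True
    then have "e l m = d n l" "e j i = d n j" by (auto simp: e_def)
    then show ?thesis by (simp add: F_weight_product)
  next
    case False
    then have "?K i m = (0 :: ('a zvar, complex) mpoly)"
      by (intro coupling_eq_0[of n \<epsilon> i m]) (use \<epsilon> in blast)+
    then show ?thesis by simp
  qed
  have F_diff: "F n (p - q) = F n p - F n q" for p q
    using F_add[of n "p - q" q] by simp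
  have F_K: "F n (?K i j) = ?K i j" for i j
    by (simp add: coupling_def F_Const)
  show "F n (lifted_bracket n \<epsilon> (Var u) (Var v)) = ?b (F n (Var u)) (F n (Var v))" for u v
  proof (cases u; cases v)
    fix i j l m assume uv: "u = (i, j)" "v = (l, m)"
    have "?b (F n (Var u)) (F n (Var v))
        = ?K i m * (?z l ^ e l m * ?w j ^ e j i) - ?K l j * (?z i ^ e i j * ?w m ^ e m l)"
      unfolding uv F_Var Leibniz_left Leibniz_right zz ww zw[OF e e] wz[OF e e]
      by (simp add: algebra_simps)
    also have "\<dots> = F n (lifted_bracket n \<epsilon> (Var u) (Var v))"
      unfolding K_weight_product by (simp add: uv lifted_bracket_Var F_diff F_mult F_K K_weight_product)
    finally show ?thesis by simp
  qed
qed

theorem theorem3: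
  fixes n :: "'k :: {finite, linorder} \<Rightarrow> nat"
    and \<epsilon> :: "real^('k :: {finite, linorder})^('k :: {finite, linorder})"
  assumes "CARD('k) > 1"
    and "\<And>i. n i > 0"
    and "Gcd (range n) = 1"
    and "minimal_hilbert_basis n"
    and "\<And>i j. \<epsilon> $ i $ j = \<epsilon> $ j $ i"
    and "\<And>i j. \<not> (d n i = 1 \<and> d n j = 1) \<Longrightarrow> \<epsilon> $ i $ j = 0"
  shows "\<exists>br. poisson_on UNIV br \<and> real_bracket br \<and>
           poisson_related (F n) UNIV br (algebra_S n) (bracket_eps \<epsilon>)"
proof (intro exI conjI)
  show "poisson_on UNIV (lifted_bracket n \<epsilon>)"
    using assms(6) by (rule poisson_on_lifted_bracket)
  show "real_bracket (lifted_bracket n \<epsilon>)"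
    unfolding real_bracket_def
    by (intro allI conj_swap_fixed_imp_real)
      (simp only: conj_swap_lifted_bracket[OF assms(5)] conj_swap_real_coord)
  show "poisson_related (F n) UNIV (lifted_bracket n \<epsilon>) (algebra_S n) (bracket_eps \<epsilon>)"
    unfolding poisson_related_def
    using F_lifted_bracket[of n \<epsilon>] assms(6) F_in_algebra_S[OF assms(4)] by blast
qed

end
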